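(* Let $\alpha,\beta,\gamma,\delta$ be constants with $\gamma+\delta\neq 0$ and $(\alpha\gamma,\beta\delta)\neq(0,0)$. Consider the linear problem $$\psi_{n,y}=q_n\left(\gamma\phi_n+\delta\phi_{n+1}\right),\qquad \phi_{n+1}-\phi_n=r_n\psi_n, \qquad (\mathrm{A})$$ together with the time evolution $$\mathrm{i}\psi_{n,t_1}=\alpha u_n^{\gamma}\psi_{n-1}+\beta u_{n+1}^{\delta}\psi_{n+1}+w_n\psi_n,\qquad \mathrm{i}\phi_{n,t_1}=-\alpha u_n^{\gamma}r_n\psi_{n-1}+\beta u_n^{\delta}r_{n-1}\psi_n. \qquad (\mathrm{B})$$ Then the compatibility conditions of the overdetermined linear systems (A) and (B) for $\psi_n$ and $\phi_n$ are equivalent to the system of differential-difference equations $$\mathrm{i}q_{n,t_1}-\alpha u_n^{\gamma}q_{n-1}-\beta u_{n+1}^{\delta}q_{n+1}-w_nq_n=0,$$ $$\mathrm{i}r_{n,t_1}+\beta u_n^{\delta}r_{n-1}+\alpha u_{n+1}^{\gamma}r_{n+1}+w_nr_n=0,$$ $$u_{n,y}=u_n\left(q_{n-1}r_{n-1}-q_nr_n\right),$$ $$w_{n,y}=\alpha\delta\left(u_n^{\gamma}q_{n-1}r_n-u_{n+1}^{\gamma}q_nr_{n+1}\right)+\beta\gamma\left(u_n^{\delta}q_nr_{n-1}-u_{n+1}^{\delta}q_{n+1}r_n\right)$$ (for all $n\in\mathbb{Z}$).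
   Context: Here $n\in\mathbb{Z}$ is a discrete variable, $y$ and $t_1$ are continuous variables, and subscripts $y,t_1$ denote partial differentiation. All functions are smooth in the continuous variables. For a fixed positive integer $M$: $q_n$ is an $M$-component row vector, $r_n$ an $M$-component column vector, $u_n$ and $w_n$ are scalars, $\psi_n$ is a scalar and $\phi_n$ an $M$-component column vector; thus $q_mr_n$ and $q_m\phi_n$ are scalars. The scalar $u_n$ is nowhere zero, a smooth branch of $\log u_n$ is fixed, and $u_n^{c}:=\exp(c\log u_n)$. "Compatibility conditions" of (A) and (B) means the requirements $\psi_{n,yt_1}=\psi_{n,t_1y}$ and $(r_n\psi_n+\phi_n-\phi_{n+1})_{t_1}=0$ for all $n$, where all derivatives of $\psi$ and $\phi$ are evaluated by means of (A) and (B), imposed for generic $\psi_n,\phi_n$: after using (A) and (B) to express everything linearly in $\phi_n,\psi_{n-1},\psi_n,\psi_{n+1}$, these quantities are regarded as independent, so each coefficient must vanish. *)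

theory Defs
  imports "HOL-Analysis.Analysis"
begin

(* A point of the plane is p = (y, t1); a lattice field is indexed by the site n. *)
type_synonym 'a lattice_field = "int \<Rightarrow> real \<times> real \<Rightarrow> 'a"

definition d_y :: "(real \<times> real \<Rightarrow> 'a::real_normed_vector) \<Rightarrow> real \<times> real \<Rightarrow> 'a" where
  "d_y f p = vector_derivative (\<lambda>s. f (s, snd p)) (at (fst p))"

definition d_t :: "(real \<times> real \<Rightarrow> 'a::real_normed_vector) \<Rightarrow> real \<times> real \<Rightarrow> 'a" where
  "d_t f p = vector_derivative (\<lambda>s. f (fst p, s)) (at (snd p))"

(* k times continuously differentiable on D (meant for open D). *)
primrec C_diff_on ::
  "nat \<Rightarrow> (real \<times> real) set \<Rightarrow> (real \<times> real \<Rightarrow> 'a::real_normed_vector) \<Rightarrow> bool" where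
  "C_diff_on 0 D f = continuous_on D f"
| "C_diff_on (Suc k) D f =
    (\<exists>fy ft. (\<forall>p\<in>D. (f has_derivative (\<lambda>h. fst h *\<^sub>R fy p + snd h *\<^sub>R ft p)) (at p)) \<and>
             C_diff_on k D fy \<and> C_diff_on k D ft)"

definition smooth_on_plane ::
  "(real \<times> real) set \<Rightarrow> (real \<times> real \<Rightarrow> 'a::real_normed_vector) \<Rightarrow> bool" where
  "smooth_on_plane D f \<longleftrightarrow> (\<forall>k. C_diff_on k D f)"

(* Row vector times column vector: complex bilinear, with no conjugation, unlike inner. *)
definition row_col :: "complex ^ 'm \<Rightarrow> complex ^ 'm \<Rightarrow> complex" (infixl "\<cdot>" 70) where
  "a \<cdot> b = (\<Sum>i\<in>UNIV. a $ i * b $ i)"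

(* The power u_n^c with respect to the branch L_n of log u_n. *)
definition branch_pow :: "complex lattice_field \<Rightarrow> complex \<Rightarrow> complex lattice_field" where
  "branch_pow L c n p = exp (c * L n p)"

definition psi_y_rhs ::
  "complex \<Rightarrow> complex \<Rightarrow> (complex ^ 'm) lattice_field \<Rightarrow>
   (complex ^ 'm) lattice_field \<Rightarrow> complex lattice_field" where
  "psi_y_rhs \<gamma> \<delta> q \<phi> n p = q n p \<cdot> (\<gamma> *s \<phi> n p + \<delta> *s \<phi> (n + 1) p)"

definition i_psi_t_rhs ::
  "complex \<Rightarrow> complex \<Rightarrow> complex \<Rightarrow> complex \<Rightarrow> complex lattice_field \<Rightarrow> complex lattice_field \<Rightarrow>
   complex lattice_field \<Rightarrow> complex lattice_field" where
  "i_psi_t_rhs \<alpha> \<beta> \<gamma> \<delta> L w \<psi> n p =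
     \<alpha> * branch_pow L \<gamma> n p * \<psi> (n - 1) p
     + \<beta> * branch_pow L \<delta> (n + 1) p * \<psi> (n + 1) p
     + w n p * \<psi> n p"

definition i_phi_t_rhs ::
  "complex \<Rightarrow> complex \<Rightarrow> complex \<Rightarrow> complex \<Rightarrow> complex lattice_field \<Rightarrow>
   (complex ^ 'm) lattice_field \<Rightarrow> complex lattice_field \<Rightarrow> (complex ^ 'm) lattice_field" where
  "i_phi_t_rhs \<alpha> \<beta> \<gamma> \<delta> L r \<psi> n p =
     - ((\<alpha> * branch_pow L \<gamma> n p * \<psi> (n - 1) p) *s r n p)
     + (\<beta> * branch_pow L \<delta> n p * \<psi> n p) *s r (n - 1) p"

definition linear_problem_at ::
  "complex \<Rightarrow> complex \<Rightarrow> (complex ^ 'm) lattice_field \<Rightarrow> (complex ^ 'm) lattice_field \<Rightarrow>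
   complex lattice_field \<Rightarrow> (complex ^ 'm) lattice_field \<Rightarrow> real \<times> real \<Rightarrow> bool" where
  "linear_problem_at \<gamma> \<delta> q r \<psi> \<phi> p \<longleftrightarrow>
     (\<forall>n. d_y (\<psi> n) p = psi_y_rhs \<gamma> \<delta> q \<phi> n p \<and>
          \<phi> (n + 1) p - \<phi> n p = \<psi> n p *s r n p)"

definition time_evolution_at ::
  "complex \<Rightarrow> complex \<Rightarrow> complex \<Rightarrow> complex \<Rightarrow> (complex ^ 'm) lattice_field \<Rightarrow>
   complex lattice_field \<Rightarrow> complex lattice_field \<Rightarrow>
   complex lattice_field \<Rightarrow> (complex ^ 'm) lattice_field \<Rightarrow> real \<times> real \<Rightarrow> bool" where
  "time_evolution_at \<alpha> \<beta> \<gamma> \<delta> r L w \<psi> \<phi> p \<longleftrightarrow>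
     (\<forall>n. \<i> * d_t (\<psi> n) p = i_psi_t_rhs \<alpha> \<beta> \<gamma> \<delta> L w \<psi> n p \<and>
          \<i> *s d_t (\<phi> n) p = i_phi_t_rhs \<alpha> \<beta> \<gamma> \<delta> L r \<psi> n p)"

(* The cross derivatives psi_{n,y t1} and psi_{n,t1 y} are the t1-derivative of the right-hand
   side of the linear problem and the y-derivative of the right-hand side of the time evolution.
   The first derivatives of psi and phi that then occur are to be evaluated by means of the two
   systems, for generic psi and phi; hence psi, phi solve both systems only at the point p under
   consideration.  Apart from phi_{n+1} - phi_n = r_n psi_n this leaves the values at p free:
   phi_n, psi_{n-1}, psi_n, psi_{n+1} are arbitrary and independent, and as the conditions are
   linear in them, requiring the conditions for all psi, phi says that each coefficient vanishes.
   Quantifying over common solutions on all of D would instead be wrong: incompatible systems may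
   have too few of them. *)
definition compatibility_conditions ::
  "(real \<times> real) set \<Rightarrow> complex \<Rightarrow> complex \<Rightarrow> complex \<Rightarrow> complex \<Rightarrow>
   (complex ^ 'm) lattice_field \<Rightarrow> (complex ^ 'm) lattice_field \<Rightarrow>
   complex lattice_field \<Rightarrow> complex lattice_field \<Rightarrow> bool" where
  "compatibility_conditions D \<alpha> \<beta> \<gamma> \<delta> q r L w \<longleftrightarrow>
     (\<forall>p\<in>D. \<forall>\<psi> \<phi>.
        (\<forall>n. smooth_on_plane D (\<psi> n)) \<and> (\<forall>n. smooth_on_plane D (\<phi> n)) \<and>
        linear_problem_at \<gamma> \<delta> q r \<psi> \<phi> p \<and>
        time_evolution_at \<alpha> \<beta> \<gamma> \<delta> r L w \<psi> \<phi> p \<longrightarrow>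
        (\<forall>n. d_t (psi_y_rhs \<gamma> \<delta> q \<phi> n) p
               = d_y (\<lambda>p'. i_psi_t_rhs \<alpha> \<beta> \<gamma> \<delta> L w \<psi> n p' / \<i>) p \<and>
             d_t (\<lambda>p'. \<psi> n p' *s r n p' + \<phi> n p' - \<phi> (n + 1) p') p = 0))"

end

theory Submission
  imports Defs
begin

text \<open>
  Modulo (A) and (B), the two compatibility defects are linear forms in the free data
  $\phi_n$, $\psi_{n-1}$, $\psi_n$, $\psi_{n+1}$, whose coefficients are combinations of the
  residuals of the four lattice equations.  Conversely, all these data can be prescribed at a
  point: functions that are affine in $(y, t_1)$ realise any values and any first derivatives
  there.  The equation for $u_n$ appears as $(\log u_n)_y = q_{n-1} r_{n-1} - q_n r_n$ with the
  factors $\alpha\gamma$ and $\beta\delta$ (at the sites $n$ and $n+1$), one of which is nonzero.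
\<close>

section \<open>Bilinear algebra of row and column vectors\<close>

text \<open>In finite dimension real bilinearity already gives boundedness. The bounded form
  supplies both the product rule for derivatives and the arithmetic collected in
  \<open>row_col_simps\<close>.\<close>

lemma bounded_bilinear_row_col: "bounded_bilinear (row_col :: complex ^ 'm \<Rightarrow> _)"
  unfolding bilinear_conv_bounded_bilinear[symmetric] bilinear_def linear_iff row_col_def
  by (auto simp: algebra_simps sum.distrib scaleR_sum_right)

lemma bounded_bilinear_vector_smult:
  "bounded_bilinear ((*s) :: complex \<Rightarrow> complex ^ 'm \<Rightarrow> _)"
  unfolding bilinear_conv_bounded_bilinear[symmetric] bilinear_def linear_iff
  by (auto simp: algebra_simps vec_eq_iff)

lemmas row_col_simps =
  bounded_bilinear.add_left[OF bounded_bilinear_row_col]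
  bounded_bilinear.add_right[OF bounded_bilinear_row_col]
  bounded_bilinear.diff_left[OF bounded_bilinear_row_col]
  bounded_bilinear.diff_right[OF bounded_bilinear_row_col]
  bounded_bilinear.minus_left[OF bounded_bilinear_row_col]
  bounded_bilinear.minus_right[OF bounded_bilinear_row_col]
  bounded_bilinear.zero_left[OF bounded_bilinear_row_col]
  bounded_bilinear.zero_right[OF bounded_bilinear_row_col]

lemma row_col_smult_left: "(c *s a) \<cdot> b = c * (a \<cdot> b)"
  by (simp add: row_col_def sum_distrib_left mult.assoc)

lemma row_col_smult_right: "a \<cdot> (c *s b) = c * (a \<cdot> b)"
  by (simp add: row_col_def sum_distrib_left mult_ac)

lemma row_col_axis: "a \<cdot> axis i 1 = a $ i"
  by (simp add: row_col_def axis_def if_distrib cong: if_cong)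

text \<open>Testing on the coordinate vectors suffices. This is how the vector coefficient of a free
  column vector is shown to vanish.\<close>

lemma row_col_eq_0_all: "(\<forall>v. a \<cdot> v = 0) \<Longrightarrow> a = 0"
  by (metis row_col_axis vec_eq_iff zero_index)

section \<open>Partial derivatives of smooth fields\<close>

text \<open>\<open>d_y\<close> and \<open>d_t\<close> are defined through
  \<open>vector_derivative\<close>, which is meaningful only where a derivative exists. The
  first-order part of smoothness, restricted by the chain rule to the two coordinate lines through
  \<open>p\<close>, provides it.\<close>

lemma smooth_has_partial_derivatives:
  assumes "smooth_on_plane D f" and "p \<in> D"
  shows "((\<lambda>s. f (s, snd p)) has_vector_derivative d_y f p) (at (fst p))"
    and "((\<lambda>s. f (fst p, s)) has_vector_derivative d_t f p) (at (snd p))"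
proof -
  have "C_diff_on (Suc 0) D f"
    using assms(1) unfolding smooth_on_plane_def by blast
  then obtain fy ft where
    f: "(f has_derivative (\<lambda>h. fst h *\<^sub>R fy p + snd h *\<^sub>R ft p)) (at p)"
    using assms(2) by auto
  have "((\<lambda>s. f (s, snd p)) has_derivative (\<lambda>h. h *\<^sub>R fy p)) (at (fst p))"
    using has_derivative_compose[OF
        has_derivative_Pair[OF has_derivative_ident has_derivative_const[of "snd p"]],
        of f _ "fst p"] f by fastforce
  then have "((\<lambda>s. f (s, snd p)) has_vector_derivative fy p) (at (fst p))"
    by (simp add: has_vector_derivative_def)
  then show "((\<lambda>s. f (s, snd p)) has_vector_derivative d_y f p) (at (fst p))"
    unfolding d_y_def by (simp add: vector_derivative_at)
  have "((\<lambda>s. f (fst p, s)) has_derivative (\<lambda>h. h *\<^sub>R ft p)) (at (snd p))"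
    using has_derivative_compose[OF
        has_derivative_Pair[OF has_derivative_const[of "fst p"] has_derivative_ident],
        of f _ "snd p"] f by fastforce
  then have "((\<lambda>s. f (fst p, s)) has_vector_derivative ft p) (at (snd p))"
    by (simp add: has_vector_derivative_def)
  then show "((\<lambda>s. f (fst p, s)) has_vector_derivative d_t f p) (at (snd p))"
    unfolding d_t_def by (simp add: vector_derivative_at)
qed

section \<open>Fields with prescribed first-order data at a point\<close>

lemma smooth_on_plane_const: "smooth_on_plane D (\<lambda>_. c)"
proof -
  \<comment> \<open>The constant is quantified inside the induction, because the partial derivatives
    are the different constant 0.\<close>
  have "\<forall>c :: 'a. C_diff_on k D (\<lambda>_. c)" for k
    by (induction k) (auto intro!: exI[of _ "\<lambda>_. 0"])
  then show ?thesis
    by (simp add: smooth_on_plane_def)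
qed

definition affine_field :: "real \<times> real \<Rightarrow> 'a \<Rightarrow> 'a \<Rightarrow> 'a \<Rightarrow> real \<times> real \<Rightarrow> 'a::real_normed_vector"
  where "affine_field p c a b x = c + (fst x - fst p) *\<^sub>R a + (snd x - snd p) *\<^sub>R b"

lemma smooth_affine_field: "smooth_on_plane D (affine_field p c a b)"
  unfolding smooth_on_plane_def
proof
  fix k
  have diff: "(affine_field p c a b has_derivative (\<lambda>h. fst h *\<^sub>R a + snd h *\<^sub>R b)) (at x)" for x
    unfolding affine_field_def by (auto intro!: derivative_eq_intros)
  show "C_diff_on k D (affine_field p c a b)"
  proof (cases k)
    case 0
    then show ?thesis
      unfolding affine_field_def by (auto intro!: continuous_intros)
  next
    case (Suc j)
    then show ?thesis
      using diff smooth_on_plane_const[of D a] smooth_on_plane_const[of D b]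
      unfolding Suc C_diff_on.simps smooth_on_plane_def
      by (intro exI[of _ "\<lambda>_. a"] exI[of _ "\<lambda>_. b"]) simp
  qed
qed

lemma affine_field_at [simp]:
  "affine_field p c a b p = c"
  "d_y (affine_field p c a b) p = a"
  "d_t (affine_field p c a b) p = b"
  by (auto simp: affine_field_def d_y_def d_t_def intro!: vector_derivative_at derivative_eq_intros)

text \<open>Summation from \<open>n\<close> in both directions: at each \<open>k\<close> at least
  one of the two sums is empty, so a single formula covers both sides of \<open>n\<close>.\<close>

lemma int_recurrence_exists:
  fixes s :: "int \<Rightarrow> 'a::ab_group_add"
  shows "\<exists>f. f n = v \<and> (\<forall>k. f (k + 1) - f k = s k)"
proof -
  define f where "f k = v + sum s {n..<k} - sum s {k..<n}" for k
  have "f (k + 1) - f k = s k" for k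
  proof (cases "n \<le> k")
    case True
    then have "{n..<k + 1} = insert k {n..<k}" by auto
    then show ?thesis using True by (simp add: f_def)
  next
    case False
    then have "{k..<n} = insert k {k + 1..<n}" by auto
    then show ?thesis using False by (simp add: f_def)
  qed
  then show ?thesis by (intro exI[of _ f]) (simp add: f_def)
qed

text \<open>This makes the data generic: \<open>c\<close> fixes \<open>\<psi>\<close> at all sites
  and \<open>v\<close> fixes \<open>\<phi>\<close> at one site. The difference equation in (A) then
  forces the values of \<open>\<phi>\<close> at the other sites, while the remaining equations only
  prescribe slopes at \<open>p\<close>.\<close>

lemma local_solution_exists:
  fixes q r :: "(complex ^ 'm) lattice_field"
  obtains \<psi> \<phi> where
    "\<And>k. smooth_on_plane D (\<psi> k)" "\<And>k. smooth_on_plane D (\<phi> k)"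
    "linear_problem_at \<gamma> \<delta> q r \<psi> \<phi> p" "time_evolution_at \<alpha> \<beta> \<gamma> \<delta> r L w \<psi> \<phi> p"
    "\<And>k. \<psi> k p = c k" "\<phi> n p = v"
proof -
  obtain f where f: "f n = v" "\<And>k. f (k + 1) - f k = c k *s r k p"
    using int_recurrence_exists[of n v "\<lambda>k. c k *s r k p"] by auto
  \<comment> \<open>The right-hand sides of (A) and (B) involve \<open>\<psi>\<close> and
    \<open>\<phi>\<close> only through their values at \<open>p\<close>. Constant fields with these
    values yield the required slopes before \<open>\<psi>\<close> and \<open>\<phi>\<close> are
    defined.\<close>
  define \<phi>0 :: "(complex ^ 'm) lattice_field" where "\<phi>0 k x = f k" for k x
  define \<psi>0 :: "complex lattice_field" where "\<psi>0 k x = c k" for k x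
  define \<psi> where "\<psi> k = affine_field p (c k) (psi_y_rhs \<gamma> \<delta> q \<phi>0 k p)
    (i_psi_t_rhs \<alpha> \<beta> \<gamma> \<delta> L w \<psi>0 k p / \<i>)" for k
  \<comment> \<open>Neither (A) nor (B) prescribes the y-derivative of \<open>\<phi>\<close>; the
    slope 0 is an arbitrary choice.\<close>
  define \<phi> where "\<phi> k = affine_field p (f k) 0
    ((1 / \<i>) *s i_phi_t_rhs \<alpha> \<beta> \<gamma> \<delta> L r \<psi>0 k p)" for k
  show ?thesis
  proof (rule that[of \<psi> \<phi>])
    show "linear_problem_at \<gamma> \<delta> q r \<psi> \<phi> p"
      using f(2) by (simp add: linear_problem_at_def \<psi>_def \<phi>_def psi_y_rhs_def \<phi>0_def)
    show "time_evolution_at \<alpha> \<beta> \<gamma> \<delta> r L w \<psi> \<phi> p"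
      by (simp add: time_evolution_at_def \<psi>_def \<phi>_def i_psi_t_rhs_def i_phi_t_rhs_def \<psi>0_def
          vector_smult_assoc)
  qed (simp_all add: \<psi>_def \<phi>_def smooth_affine_field f(1))
qed

section \<open>Differentiation of the branch powers and of both sides of the compatibility
  conditions\<close>

lemma branch_pow_has_y_derivative:
  assumes "smooth_on_plane D (L n)" and "p \<in> D"
  shows "((\<lambda>s. branch_pow L c n (s, snd p)) has_vector_derivative
           c * branch_pow L c n p * d_y (L n) p) (at (fst p))"
proof -
  have "((\<lambda>s. c * L n (s, snd p)) has_vector_derivative c * d_y (L n) p) (at (fst p))"
    by (intro has_vector_derivative_mult_right smooth_has_partial_derivatives(1)[OF assms])
  from field_vector_diff_chain_at[OF this DERIV_exp]
  show ?thesis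
    by (simp add: branch_pow_def[abs_def] o_def mult_ac)
qed

lemma d_y_exp_branch:
  fixes L u :: "complex lattice_field"
  assumes "open D" and "p \<in> D" and "smooth_on_plane D (L n)"
    and "\<And>x. x \<in> D \<Longrightarrow> exp (L n x) = u n x"
  shows "d_y (u n) p = u n p * d_y (L n) p"
proof -
  \<comment> \<open>The branch power with exponent 1 agrees with \<open>u\<close> on
    \<open>D\<close>. Since \<open>D\<close> is open, its slice through \<open>p\<close> is an open
    set of the line, so the derivative carries over.\<close>
  have "((\<lambda>s. u n (s, snd p)) has_vector_derivative 1 * branch_pow L 1 n p * d_y (L n) p)
    (at (fst p))"
  proof (rule has_vector_derivative_transform_within_open[OF branch_pow_has_y_derivative])
    have "continuous_on UNIV (\<lambda>s. (s, snd p))"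
      by (intro continuous_intros)
    then have "open ((\<lambda>s. (s, snd p)) -` D)"
      using assms(1) by (auto intro: open_vimage)
    then show "open {s. (s, snd p) \<in> D}"
      by (simp add: vimage_def)
  qed (use assms in \<open>auto simp: branch_pow_def\<close>)
  then have "d_y (u n) p = branch_pow L 1 n p * d_y (L n) p"
    unfolding d_y_def by (simp add: vector_derivative_at)
  then show ?thesis
    using assms(2,4) by (simp add: branch_pow_def)
qed

lemma d_t_psi_y_rhs:
  assumes "smooth_on_plane D (q n)" and "\<And>k. smooth_on_plane D (\<phi> k)" and "p \<in> D"
  shows "d_t (psi_y_rhs \<gamma> \<delta> q \<phi> n) p =
    d_t (q n) p \<cdot> (\<gamma> *s \<phi> n p + \<delta> *s \<phi> (n + 1) p)
    + q n p \<cdot> (\<gamma> *s d_t (\<phi> n) p + \<delta> *s d_t (\<phi> (n + 1)) p)"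
proof -
  note D = smooth_has_partial_derivatives(2)[OF _ assms(3)]
  note smult = bounded_linear.has_vector_derivative[OF
      bounded_bilinear.bounded_linear_right[OF bounded_bilinear_vector_smult]]
  have "((\<lambda>s. psi_y_rhs \<gamma> \<delta> q \<phi> n (fst p, s)) has_vector_derivative
     q n p \<cdot> (\<gamma> *s d_t (\<phi> n) p + \<delta> *s d_t (\<phi> (n + 1)) p)
     + d_t (q n) p \<cdot> (\<gamma> *s \<phi> n p + \<delta> *s \<phi> (n + 1) p)) (at (snd p))"
    unfolding psi_y_rhs_def
    using bounded_bilinear.has_vector_derivative[OF bounded_bilinear_row_col D[OF assms(1)]
        has_vector_derivative_add[OF smult[OF D[OF assms(2)]] smult[OF D[OF assms(2)]]],
        of \<gamma> n \<delta> "n + 1"]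
    by simp
  then show ?thesis
    unfolding d_t_def by (simp add: vector_derivative_at add.commute)
qed

lemma d_y_i_psi_t_rhs:
  assumes "\<And>k. smooth_on_plane D (L k)" and "smooth_on_plane D (w n)"
    and "\<And>k. smooth_on_plane D (\<psi> k)" and "p \<in> D"
  shows "d_y (\<lambda>x. i_psi_t_rhs \<alpha> \<beta> \<gamma> \<delta> L w \<psi> n x / \<i>) p =
    (\<alpha> * branch_pow L \<gamma> n p * (\<gamma> * d_y (L n) p * \<psi> (n - 1) p + d_y (\<psi> (n - 1)) p)
     + \<beta> * branch_pow L \<delta> (n + 1) p *
       (\<delta> * d_y (L (n + 1)) p * \<psi> (n + 1) p + d_y (\<psi> (n + 1)) p)
     + d_y (w n) p * \<psi> n p + w n p * d_y (\<psi> n) p) / \<i>"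
proof -
  note D = smooth_has_partial_derivatives(1)[OF _ assms(4)]
  note B = branch_pow_has_y_derivative[where L = L, OF assms(1,4)]
  have "((\<lambda>s. i_psi_t_rhs \<alpha> \<beta> \<gamma> \<delta> L w \<psi> n (s, snd p) / \<i>) has_vector_derivative
    (\<alpha> * branch_pow L \<gamma> n p * (\<gamma> * d_y (L n) p * \<psi> (n - 1) p + d_y (\<psi> (n - 1)) p)
     + \<beta> * branch_pow L \<delta> (n + 1) p *
       (\<delta> * d_y (L (n + 1)) p * \<psi> (n + 1) p + d_y (\<psi> (n + 1)) p)
     + d_y (w n) p * \<psi> n p + w n p * d_y (\<psi> n) p) / \<i>) (at (fst p))"
    unfolding i_psi_t_rhs_def
    by (rule derivative_eq_intros D assms B refl | simp add: algebra_simps)+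
  then show ?thesis
    unfolding d_y_def by (simp add: vector_derivative_at)
qed

lemma d_t_difference_defect:
  fixes r \<phi> :: "(complex ^ 'm) lattice_field"
  assumes "smooth_on_plane D (r n)" and "\<And>k. smooth_on_plane D (\<psi> k)"
    and "\<And>k. smooth_on_plane D (\<phi> k)" and "p \<in> D"
  shows "d_t (\<lambda>x. \<psi> n x *s r n x + \<phi> n x - \<phi> (n + 1) x) p =
    \<psi> n p *s d_t (r n) p + d_t (\<psi> n) p *s r n p + d_t (\<phi> n) p - d_t (\<phi> (n + 1)) p"
proof -
  note D = smooth_has_partial_derivatives(2)[OF _ assms(4)]
  have "((\<lambda>s. \<psi> n (fst p, s) *s r n (fst p, s) + \<phi> n (fst p, s) - \<phi> (n + 1) (fst p, s))
      has_vector_derivative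
      \<psi> n p *s d_t (r n) p + d_t (\<psi> n) p *s r n p + d_t (\<phi> n) p - d_t (\<phi> (n + 1)) p) (at (snd p))"
    using bounded_bilinear.has_vector_derivative[OF bounded_bilinear_vector_smult
        D[OF assms(2)] D[OF assms(1)], of n]
    by (intro has_vector_derivative_diff has_vector_derivative_add D assms) simp
  then show ?thesis
    unfolding d_t_def by (simp add: vector_derivative_at)
qed

section \<open>Residuals of the lattice equations and the two defects\<close>

definition q_residual where
  "q_residual \<alpha> \<beta> \<gamma> \<delta> q L w n p = \<i> *s d_t (q n) p
        - (\<alpha> * branch_pow L \<gamma> n p) *s q (n - 1) p
        - (\<beta> * branch_pow L \<delta> (n + 1) p) *s q (n + 1) p
        - w n p *s q n p"

definition r_residual where
  "r_residual \<alpha> \<beta> \<gamma> \<delta> r L w n p = \<i> *s d_t (r n) p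
        + (\<beta> * branch_pow L \<delta> n p) *s r (n - 1) p
        + (\<alpha> * branch_pow L \<gamma> (n + 1) p) *s r (n + 1) p
        + w n p *s r n p"

text \<open>The logarithmic form of the equation for u. It is stated with \<open>L\<close>, since
  the compatibility conditions see u only through the branch powers.\<close>

definition log_u_residual where
  "log_u_residual q r L n p = d_y (L n) p - (q (n - 1) p \<cdot> r (n - 1) p - q n p \<cdot> r n p)"

definition w_residual where
  "w_residual \<alpha> \<beta> \<gamma> \<delta> q r L w n p = d_y (w n) p
        - (\<alpha> * \<delta> * (branch_pow L \<gamma> n p * (q (n - 1) p \<cdot> r n p)
                 - branch_pow L \<gamma> (n + 1) p * (q n p \<cdot> r (n + 1) p))
        + \<beta> * \<gamma> * (branch_pow L \<delta> n p * (q n p \<cdot> r (n - 1) p)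
                 - branch_pow L \<delta> (n + 1) p * (q (n + 1) p \<cdot> r n p)))"

text \<open>All sites of \<open>\<phi>\<close> are reduced to \<open>\<phi> n\<close> modulo values
  of \<open>\<psi>\<close>, which produces the factor \<open>\<gamma> + \<delta>\<close>. The
  substitution of \<open>\<phi> (n + 1)\<close> also brings the t-derivative of \<open>q n\<close>,
  paired with \<open>r n\<close>, into the coefficient of \<open>\<psi> n\<close>. Completing it to
  the q-residual leaves exactly the w-residual.\<close>

lemma cross_derivative_defect:
  fixes q r \<phi> :: "(complex ^ 'm) lattice_field"
  assumes "\<And>k. smooth_on_plane D (q k)" and "\<And>k. smooth_on_plane D (L k)"
    and "\<And>k. smooth_on_plane D (w k)"
    and "\<And>k. smooth_on_plane D (\<psi> k)" and "\<And>k. smooth_on_plane D (\<phi> k)" and "p \<in> D"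
    and A: "linear_problem_at \<gamma> \<delta> q r \<psi> \<phi> p"
    and B: "time_evolution_at \<alpha> \<beta> \<gamma> \<delta> r L w \<psi> \<phi> p"
  shows "\<i> * (d_t (psi_y_rhs \<gamma> \<delta> q \<phi> n) p
               - d_y (\<lambda>x. i_psi_t_rhs \<alpha> \<beta> \<gamma> \<delta> L w \<psi> n x / \<i>) p) =
    (\<gamma> + \<delta>) * (q_residual \<alpha> \<beta> \<gamma> \<delta> q L w n p \<cdot> \<phi> n p)
    - \<alpha> * \<gamma> * branch_pow L \<gamma> n p * log_u_residual q r L n p * \<psi> (n - 1) p
    + (\<delta> * (q_residual \<alpha> \<beta> \<gamma> \<delta> q L w n p \<cdot> r n p)
       - w_residual \<alpha> \<beta> \<gamma> \<delta> q r L w n p) * \<psi> n p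
    - \<beta> * \<delta> * branch_pow L \<delta> (n + 1) p * log_u_residual q r L (n + 1) p * \<psi> (n + 1) p"
proof -
  have \<phi>: "\<phi> (k + 1) p = \<phi> k p + \<psi> k p *s r k p" for k
    using A unfolding linear_problem_at_def by (metis add.commute diff_add_cancel)
  \<comment> \<open>The sites \<open>n - 1\<close> and \<open>n + 2\<close> enter when (A) evaluates
    the y-derivatives of \<open>\<psi> (n - 1)\<close> and \<open>\<psi> (n + 1)\<close>.\<close>
  have \<phi>1: "\<phi> (n - 1) p = \<phi> n p - \<psi> (n - 1) p *s r (n - 1) p"
    using \<phi>[of "n - 1"] by simp
  have \<phi>2: "\<phi> (n + 2) p = \<phi> n p + \<psi> n p *s r n p + \<psi> (n + 1) p *s r (n + 1) p"
    using \<phi>[of "n + 1"] \<phi>[of n] by (simp add: add.commute[of n 2])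
  have \<psi>y: "d_y (\<psi> k) p = q k p \<cdot> (\<gamma> *s \<phi> k p + \<delta> *s \<phi> (k + 1) p)" for k
    using A by (simp add: linear_problem_at_def psi_y_rhs_def)
  have \<phi>t: "\<i> *s d_t (\<phi> k) p = i_phi_t_rhs \<alpha> \<beta> \<gamma> \<delta> L r \<psi> k p" for k
    using B by (simp add: time_evolution_at_def)
  \<comment> \<open>(B) determines \<open>\<i>\<close> times the t-derivative, so the overall factor
    \<open>\<i>\<close> is absorbed here instead of dividing by it.\<close>
  have i\<phi>t: "\<i> * (a \<cdot> d_t (\<phi> k) p) = a \<cdot> i_phi_t_rhs \<alpha> \<beta> \<gamma> \<delta> L r \<psi> k p" for a k
    by (simp flip: \<phi>t add: row_col_smult_right)
  have lhs: "\<i> * d_t (psi_y_rhs \<gamma> \<delta> q \<phi> n) p =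
      (\<i> *s d_t (q n) p) \<cdot> (\<gamma> *s \<phi> n p + \<delta> *s \<phi> (n + 1) p)
      + \<gamma> * (q n p \<cdot> i_phi_t_rhs \<alpha> \<beta> \<gamma> \<delta> L r \<psi> n p)
      + \<delta> * (q n p \<cdot> i_phi_t_rhs \<alpha> \<beta> \<gamma> \<delta> L r \<psi> (n + 1) p)"
    unfolding d_t_psi_y_rhs[where q = q and \<phi> = \<phi>, OF assms(1,5,6)] i\<phi>t[symmetric]
    by (simp add: row_col_simps row_col_smult_left row_col_smult_right algebra_simps)
  show ?thesis
    unfolding right_diff_distrib lhs
      d_y_i_psi_t_rhs[where L = L and w = w and \<psi> = \<psi>, OF assms(2,3,4,6)]
      q_residual_def w_residual_def log_u_residual_def i_phi_t_rhs_def \<psi>y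
    by (simp add: \<phi>[of n] \<phi>[of n, unfolded add.commute[of n]] \<phi>1 \<phi>2 row_col_simps row_col_smult_left row_col_smult_right algebra_simps)
qed

text \<open>The terms with \<open>\<psi> (n - 1)\<close> cancel between the evolutions of
  \<open>\<psi> n\<close> and \<open>\<phi> n\<close>, those with \<open>\<psi> (n + 1)\<close>
  between the evolutions of \<open>\<psi> n\<close> and \<open>\<phi> (n + 1)\<close>. Only
  multiples of \<open>\<psi> n\<close> survive.\<close>

lemma difference_defect:
  fixes r \<phi> :: "(complex ^ 'm) lattice_field"
  assumes "\<And>k. smooth_on_plane D (r k)"
    and "\<And>k. smooth_on_plane D (\<psi> k)" and "\<And>k. smooth_on_plane D (\<phi> k)" and "p \<in> D"
    and B: "time_evolution_at \<alpha> \<beta> \<gamma> \<delta> r L w \<psi> \<phi> p"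
  shows "\<i> *s d_t (\<lambda>x. \<psi> n x *s r n x + \<phi> n x - \<phi> (n + 1) x) p =
    \<psi> n p *s r_residual \<alpha> \<beta> \<gamma> \<delta> r L w n p"
proof -
  have \<phi>t: "\<i> *s d_t (\<phi> k) p = i_phi_t_rhs \<alpha> \<beta> \<gamma> \<delta> L r \<psi> k p" for k
    using B by (simp add: time_evolution_at_def)
  have \<psi>t: "\<i> * d_t (\<psi> k) p = i_psi_t_rhs \<alpha> \<beta> \<gamma> \<delta> L w \<psi> k p" for k
    using B by (simp add: time_evolution_at_def)
  have "\<i> *s d_t (\<lambda>x. \<psi> n x *s r n x + \<phi> n x - \<phi> (n + 1) x) p =
      \<psi> n p *s (\<i> *s d_t (r n) p) + (\<i> * d_t (\<psi> n) p) *s r n p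
      + \<i> *s d_t (\<phi> n) p - \<i> *s d_t (\<phi> (n + 1)) p"
    unfolding d_t_difference_defect[where r = r and \<psi> = \<psi> and \<phi> = \<phi>, OF assms(1-4)]
    by (simp add: vec_eq_iff algebra_simps)
  also have "\<dots> = \<psi> n p *s r_residual \<alpha> \<beta> \<gamma> \<delta> r L w n p"
    unfolding \<phi>t \<psi>t i_phi_t_rhs_def i_psi_t_rhs_def r_residual_def
    by (simp add: vec_eq_iff algebra_simps)
  finally show ?thesis .
qed

section \<open>Comparison of coefficients and the equivalence\<close>

lemma compatibility_conditions_iff_residuals:
  fixes q r :: "(complex ^ 'm) lattice_field"
  assumes "\<gamma> + \<delta> \<noteq> 0" and "(\<alpha> * \<gamma>, \<beta> * \<delta>) \<noteq> (0, 0)"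
    and sm: "\<And>k. smooth_on_plane D (q k)" "\<And>k. smooth_on_plane D (r k)"
      "\<And>k. smooth_on_plane D (L k)" "\<And>k. smooth_on_plane D (w k)"
  shows "compatibility_conditions D \<alpha> \<beta> \<gamma> \<delta> q r L w \<longleftrightarrow>
    (\<forall>n. \<forall>p\<in>D. q_residual \<alpha> \<beta> \<gamma> \<delta> q L w n p = 0 \<and> r_residual \<alpha> \<beta> \<gamma> \<delta> r L w n p = 0 \<and>
       log_u_residual q r L n p = 0 \<and> w_residual \<alpha> \<beta> \<gamma> \<delta> q r L w n p = 0)"
    (is "_ \<longleftrightarrow> ?residuals")
proof
  assume compat: "compatibility_conditions D \<alpha> \<beta> \<gamma> \<delta> q r L w"
  \<comment> \<open>Both defects as linear forms in unrestricted data: \<open>v\<close> stands for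
    \<open>\<phi> n p\<close> and \<open>c k\<close> for \<open>\<psi> k p\<close>.\<close>
  have forms: "(\<gamma> + \<delta>) * (q_residual \<alpha> \<beta> \<gamma> \<delta> q L w n p \<cdot> v)
      - \<alpha> * \<gamma> * branch_pow L \<gamma> n p * log_u_residual q r L n p * c (n - 1)
      + (\<delta> * (q_residual \<alpha> \<beta> \<gamma> \<delta> q L w n p \<cdot> r n p)
         - w_residual \<alpha> \<beta> \<gamma> \<delta> q r L w n p) * c n
      - \<beta> * \<delta> * branch_pow L \<delta> (n + 1) p * log_u_residual q r L (n + 1) p * c (n + 1) = 0"
    "c n *s r_residual \<alpha> \<beta> \<gamma> \<delta> r L w n p = 0"
    if p: "p \<in> D" for n p v and c :: "int \<Rightarrow> complex"
  proof -
    obtain \<psi> \<phi> where sol: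
      "\<And>k. smooth_on_plane D (\<psi> k)" "\<And>k. smooth_on_plane D (\<phi> k)"
      "linear_problem_at \<gamma> \<delta> q r \<psi> \<phi> p" "time_evolution_at \<alpha> \<beta> \<gamma> \<delta> r L w \<psi> \<phi> p"
      and val: "\<And>k. \<psi> k p = c k" "\<phi> n p = v"
      using local_solution_exists by blast
    have "d_t (psi_y_rhs \<gamma> \<delta> q \<phi> n) p = d_y (\<lambda>x. i_psi_t_rhs \<alpha> \<beta> \<gamma> \<delta> L w \<psi> n x / \<i>) p"
      and "d_t (\<lambda>x. \<psi> n x *s r n x + \<phi> n x - \<phi> (n + 1) x) p = 0"
      using compat p sol unfolding compatibility_conditions_def by blast+
    then show "(\<gamma> + \<delta>) * (q_residual \<alpha> \<beta> \<gamma> \<delta> q L w n p \<cdot> v)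
      - \<alpha> * \<gamma> * branch_pow L \<gamma> n p * log_u_residual q r L n p * c (n - 1)
      + (\<delta> * (q_residual \<alpha> \<beta> \<gamma> \<delta> q L w n p \<cdot> r n p)
         - w_residual \<alpha> \<beta> \<gamma> \<delta> q r L w n p) * c n
      - \<beta> * \<delta> * branch_pow L \<delta> (n + 1) p * log_u_residual q r L (n + 1) p * c (n + 1) = 0"
      "c n *s r_residual \<alpha> \<beta> \<gamma> \<delta> r L w n p = 0"
      using cross_derivative_defect[where q = q and L = L and w = w, OF sm(1,3,4) sol(1,2) p sol(3,4), of n]
        difference_defect[where r = r, OF sm(2) sol(1,2) p sol(4), of n]
      by (simp_all add: val)
  qed
  \<comment> \<open>With all values of \<open>\<psi>\<close> zero only the term in \<open>v\<close>
    remains, and \<open>\<gamma> + \<delta>\<close> can be cancelled.\<close>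
  have q: "q_residual \<alpha> \<beta> \<gamma> \<delta> q L w n p = 0" if "p \<in> D" for n p
    using forms(1)[OF that, of n _ "\<lambda>_. 0"] assms(1) by (intro row_col_eq_0_all) simp
  have r: "r_residual \<alpha> \<beta> \<gamma> \<delta> r L w n p = 0" if "p \<in> D" for n p
    using forms(2)[OF that, of "\<lambda>_. 1" n] by simp
  \<comment> \<open>The coefficient of \<open>\<psi> n\<close> also contains the q-residual, hence
    the prior use of \<open>q\<close>.\<close>
  have w: "w_residual \<alpha> \<beta> \<gamma> \<delta> q r L w n p = 0" if "p \<in> D" for n p
    using forms(1)[OF that, of n 0 "\<lambda>k. if k = n then 1 else 0"] q[OF that]
    by (simp add: row_col_simps)
  have u: "log_u_residual q r L n p = 0" if "p \<in> D" for n p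
  proof (cases "\<alpha> * \<gamma> = 0")
    \<comment> \<open>Here the coefficient of \<open>\<psi> (n - 1)\<close> in the condition at site
      \<open>n\<close> is tested. Branch powers are exponentials and therefore cancel.\<close>
    case False
    then show ?thesis
      using forms(1)[OF that, of n 0 "\<lambda>k. if k = n - 1 then 1 else 0"]
      by (simp add: row_col_simps branch_pow_def)
  next
    \<comment> \<open>Now the last coefficient is tested, in the condition at site
      \<open>n - 1\<close>: its residual sits one site further, that is, at
      \<open>n\<close>.\<close>
    case True
    then have "\<beta> * \<delta> \<noteq> 0"
      using assms(2) by simp
    then show ?thesis
      using forms(1)[OF that, of "n - 1" 0 "\<lambda>k. if k = n then 1 else 0"]
      by (simp add: row_col_simps branch_pow_def)
  qed
  show ?residuals
    using q r u w by blast
next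
  assume res: ?residuals
  show "compatibility_conditions D \<alpha> \<beta> \<gamma> \<delta> q r L w"
    unfolding compatibility_conditions_def
  proof (intro ballI allI impI, elim conjE)
    fix p n \<psi> and \<phi> :: "(complex ^ 'm) lattice_field"
    assume p: "p \<in> D"
      and sol: "\<forall>k. smooth_on_plane D (\<psi> k)" "\<forall>k. smooth_on_plane D (\<phi> k)"
      "linear_problem_at \<gamma> \<delta> q r \<psi> \<phi> p" "time_evolution_at \<alpha> \<beta> \<gamma> \<delta> r L w \<psi> \<phi> p"
    show "d_t (psi_y_rhs \<gamma> \<delta> q \<phi> n) p = d_y (\<lambda>x. i_psi_t_rhs \<alpha> \<beta> \<gamma> \<delta> L w \<psi> n x / \<i>) p \<and>
      d_t (\<lambda>x. \<psi> n x *s r n x + \<phi> n x - \<phi> (n + 1) x) p = 0"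
      using cross_derivative_defect[where q = q and L = L and w = w,
          OF sm(1,3,4) sol(1,2)[rule_format] p sol(3,4), of n]
        difference_defect[where r = r, OF sm(2) sol(1,2)[rule_format] p sol(4), of n] res p
      by (simp add: row_col_simps)
  qed
qed

theorem proposition2p1:
  fixes \<alpha> \<beta> \<gamma> \<delta> :: complex
    and D :: "(real \<times> real) set"
    and q r :: "int \<Rightarrow> real \<times> real \<Rightarrow> complex ^ 'm"
    and u L w :: "int \<Rightarrow> real \<times> real \<Rightarrow> complex"
  assumes "open D"
    and "\<gamma> + \<delta> \<noteq> 0"
    and "(\<alpha> * \<gamma>, \<beta> * \<delta>) \<noteq> (0, 0)"
    and "\<And>n. smooth_on_plane D (q n)"
    and "\<And>n. smooth_on_plane D (r n)"
    and "\<And>n. smooth_on_plane D (u n)"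
    and "\<And>n. smooth_on_plane D (w n)"
    and "\<And>n p. p \<in> D \<Longrightarrow> u n p \<noteq> 0"
    and "\<And>n. smooth_on_plane D (L n)"
    and "\<And>n p. p \<in> D \<Longrightarrow> exp (L n p) = u n p"
  shows "compatibility_conditions D \<alpha> \<beta> \<gamma> \<delta> q r L w \<longleftrightarrow>
    (\<forall>n. \<forall>p\<in>D.
      \<i> *s d_t (q n) p
        - (\<alpha> * branch_pow L \<gamma> n p) *s q (n - 1) p
        - (\<beta> * branch_pow L \<delta> (n + 1) p) *s q (n + 1) p
        - w n p *s q n p = 0 \<and>
      \<i> *s d_t (r n) p
        + (\<beta> * branch_pow L \<delta> n p) *s r (n - 1) p
        + (\<alpha> * branch_pow L \<gamma> (n + 1) p) *s r (n + 1) p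
        + w n p *s r n p = 0 \<and>
      d_y (u n) p = u n p * (q (n - 1) p \<cdot> r (n - 1) p - q n p \<cdot> r n p) \<and>
      d_y (w n) p =
        \<alpha> * \<delta> * (branch_pow L \<gamma> n p * (q (n - 1) p \<cdot> r n p)
                 - branch_pow L \<gamma> (n + 1) p * (q n p \<cdot> r (n + 1) p))
        + \<beta> * \<gamma> * (branch_pow L \<delta> n p * (q n p \<cdot> r (n - 1) p)
                 - branch_pow L \<delta> (n + 1) p * (q (n + 1) p \<cdot> r n p)))"
proof -
  \<comment> \<open>The y-derivative of u is u times that of \<open>L\<close>, and u has no zeros on
    \<open>D\<close>, so the factor u cancels.\<close>
  have "log_u_residual q r L n p = 0 \<longleftrightarrow>
      d_y (u n) p = u n p * (q (n - 1) p \<cdot> r (n - 1) p - q n p \<cdot> r n p)" if "p \<in> D" for n p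
    using assms(8)[OF that, of n] d_y_exp_branch[where L = L and u = u, OF assms(1) that assms(9,10)]
    by (simp add: log_u_residual_def)
  then show ?thesis
    unfolding compatibility_conditions_iff_residuals[where q = q and r = r and L = L and w = w,
        OF assms(2,3,4,5,9,7)] q_residual_def r_residual_def w_residual_def
    by simp
qed

end
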